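(* Let $\mu$ be a probability measure on $\mathbb{R}$ with bounded connected support $[a,b]$, $a<b$, possibly with a finite number of atoms, and let $F$ be its c.d.f. and $q$ its quantile function. Let $n\ge1$ and let $a=x_0<x_1<\dots<x_n=b$ be a mesh of $[a,b]$. Define $$\mu_n:=F(a)\,\delta_a+\sum_{k=1}^{n}\big(F(x_k)-F(x_{k-1})\big)\,\delta_{x_k},$$ and let $q_n$ be the quantile function of $\mu_n$. Then for any $p\ge1$, $$\|q-q_n\|_{L^p(0,1)}\le\max_{1\le k\le n}(x_k-x_{k-1}).$$ In particular, for the uniform mesh $x_k=a+\frac{b-a}{n}k$, $$\|q-q_n\|_{L^p(0,1)}\le\frac{b-a}{n}.$$
   Context: For a probability measure $\nu$ on $\mathbb{R}$, its c.d.f. is $F_\nu(x)=\nu((-\infty,x])$ and its quantile function is $q_\nu(u)=\inf\{x: F_\nu(x)\ge u\}$ for $u\in(0,1)$. $\delta_x$ denotes the Dirac mass at $x$. *)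

theory Defs
  imports "HOL-Probability.Probability"
begin

definition measure_support :: "'a::topological_space measure \<Rightarrow> 'a set" where
  "measure_support M = {x. \<forall>U. open U \<longrightarrow> x \<in> U \<longrightarrow> emeasure M U > 0}"

text \<open>
  Intended for arguments \<open>0 < u < 1\<close> and probability measures, where the set below is nonempty
  and bounded below; elsewhere the value of the real infimum is irrelevant.
\<close>
definition quantile :: "real measure \<Rightarrow> real \<Rightarrow> real" where
  "quantile M u = Inf {x. cdf M x \<ge> u}"

text \<open>
  The value \<open>\<infinity>\<close> is assigned to functions outside \<open>L\<^sup>p\<close>, so that an upper bound on the norm
  includes the claim that the function belongs to \<open>L\<^sup>p\<close>.
\<close>
definition Lp_norm :: "'a measure \<Rightarrow> real \<Rightarrow> ('a \<Rightarrow> real) \<Rightarrow> ennreal" where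
  "Lp_norm M p f =
     (if f \<in> borel_measurable M \<and> integrable M (\<lambda>x. \<bar>f x\<bar> powr p)
      then ennreal ((\<integral>x. \<bar>f x\<bar> powr p \<partial>M) powr (1 / p)) else \<infinity>)"

definition mesh_measure :: "real measure \<Rightarrow> nat \<Rightarrow> (nat \<Rightarrow> real) \<Rightarrow> real measure" where
  "mesh_measure M n x = measure_of UNIV (sets borel)
     (\<lambda>A. ennreal (cdf M (x 0)) * emeasure (return borel (x 0)) A
        + (\<Sum>k=1..n. ennreal (cdf M (x k) - cdf M (x (k - 1))) * emeasure (return borel (x k)) A))"

lemma sets_mesh_measure [simp]: "sets (mesh_measure M n x) = sets borel"
  unfolding mesh_measure_def
  by (rule sets.sets_measure_of_eq [where M = borel, unfolded space_borel])

lemma emeasure_mesh_measure: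
  assumes "A \<in> sets borel"
  shows "emeasure (mesh_measure M n x) A =
    ennreal (cdf M (x 0)) * emeasure (return borel (x 0)) A
    + (\<Sum>k=1..n. ennreal (cdf M (x k) - cdf M (x (k - 1))) * emeasure (return borel (x k)) A)"
    (is "_ = ?\<mu> A")
  unfolding mesh_measure_def
proof (rule emeasure_measure_of_sigma)
  show "sigma_algebra UNIV (sets (borel :: real measure))"
    by (rule sets.sigma_algebra_axioms [where M = borel, unfolded space_borel])
  show "positive (sets borel) ?\<mu>"
    by (simp add: positive_def)
  show "countably_additive (sets borel) ?\<mu>"
  proof (rule countably_additiveI)
    fix B :: "nat \<Rightarrow> real set"
    assume B: "range B \<subseteq> sets borel" "disjoint_family B"
    have dirac: "(\<Sum>i. emeasure (return borel y) (B i)) = emeasure (return borel y) (\<Union>i. B i)"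
      for y
      using B by (intro suminf_emeasure) auto
    have "(\<Sum>i. ?\<mu> (B i)) =
        (\<Sum>i. ennreal (cdf M (x 0)) * emeasure (return borel (x 0)) (B i))
        + (\<Sum>i. \<Sum>k=1..n. ennreal (cdf M (x k) - cdf M (x (k - 1))) * emeasure (return borel (x k)) (B i))"
      by (rule suminf_add [symmetric]) (rule summableI)+
    also have "(\<Sum>i. \<Sum>k=1..n. ennreal (cdf M (x k) - cdf M (x (k - 1))) * emeasure (return borel (x k)) (B i))
        = (\<Sum>k=1..n. \<Sum>i. ennreal (cdf M (x k) - cdf M (x (k - 1))) * emeasure (return borel (x k)) (B i))"
      by (rule suminf_sum) (rule summableI)
    finally show "(\<Sum>i. ?\<mu> (B i)) = ?\<mu> (\<Union>i. B i)"
      by (simp only: ennreal_suminf_cmult dirac)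
  qed
qed (fact assms)

end

theory Submission
  imports Defs
begin

text \<open>
  Let \<open>h\<close> be the mesh width and \<open>F\<^sub>n\<close> the c.d.f. of \<open>\<mu>\<^sub>n\<close>. Then \<open>F\<^sub>n(t) = F(x\<^sub>j)\<close>, where \<open>x\<^sub>j\<close> is
  the last mesh point not exceeding \<open>t\<close>, and therefore \<open>F\<^sub>n(t) \<le> F(t) \<le> F\<^sub>n(t + h)\<close> for all \<open>t\<close>.
  For the quantile functions this means \<open>q \<le> q\<^sub>n \<le> q + h\<close> pointwise on \<open>(0, 1)\<close>.
\<close>

text \<open>A point lies outside the support iff it has an open null neighbourhood, so the
  complement is the union of all open null sets. Lindelof's property cuts this union down to a
  countable one.\<close>

lemma emeasure_Compl_measure_support:
  fixes M :: "'a::second_countable_topology measure"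
  assumes [measurable_cong]: "sets M = sets borel"
  shows "emeasure M (- measure_support M) = 0"
proof -
  define \<U> where "\<U> = {U. open U \<and> emeasure M U = 0}"
  have "\<Union>\<U> = - measure_support M"
    by (auto simp: \<U>_def measure_support_def)
  moreover obtain \<V> where \<V>: "\<V> \<subseteq> \<U>" "countable \<V>" "\<Union>\<V> = \<Union>\<U>"
    by (rule Lindelof [of \<U>]) (auto simp: \<U>_def)
  moreover have "U \<in> null_sets M" if "U \<in> \<V>" for U
    using \<V>(1) that by (auto simp: \<U>_def null_sets_def assms)
  then have "\<Union>\<V> \<in> null_sets M"
    using \<V>(2) null_sets_UN' [of \<V> "\<lambda>U. U" M] by simp
  ultimately show ?thesis
    by auto
qed

lemma
  fixes \<mu> :: "real measure"
  assumes "real_distribution \<mu>" and supp: "measure_support \<mu> \<subseteq> {a..b}"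
  shows cdf_eq_0_if_support: "t < a \<Longrightarrow> cdf \<mu> t = 0"
    and cdf_eq_1_if_support: "b \<le> t \<Longrightarrow> cdf \<mu> t = 1"
proof -
  interpret real_distribution \<mu> by fact
  \<comment> \<open>Closedness makes the complement Borel; zero outer value alone would not put it
    into \<open>null_sets\<close>.\<close>
  have "closed (measure_support \<mu>)"
    unfolding closed_def open_subopen [of "- _"] by (auto simp: measure_support_def)
  then have "- measure_support \<mu> \<in> null_sets \<mu>"
    using emeasure_Compl_measure_support [of \<mu>] by (auto simp: null_sets_def)
  then have null: "S \<in> null_sets \<mu>" if "S \<inter> {a..b} = {}" "S \<in> sets borel" for S
    using that supp by (elim null_sets_subset) auto
  show "cdf \<mu> t = 0" if "t < a"
    using null [of "{..t}"] that by (auto simp: cdf_def measure_eq_0_null_sets)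
  show "cdf \<mu> t = 1" if "b \<le> t"
    using null [of "{t<..}"] that prob_compl [of "{t<..}"]
    by (force simp: cdf_def measure_eq_0_null_sets Compl_eq_Diff_UNIV [symmetric])
qed

text \<open>The c.d.f. tends to 1 and 0 at the two ends and \<open>u\<close> lies strictly between.
  Both facts are side conditions of the \<open>cInf\<close> rules, since the real infimum is
  conditional.\<close>

lemma quantile_set_bounds:
  assumes "real_distribution M" and "0 < u" and "u < 1"
  shows "{t. u \<le> cdf M t} \<noteq> {}" and "bdd_below {t. u \<le> cdf M t}"
proof -
  interpret real_distribution M by fact
  have "\<forall>\<^sub>F t in at_top. u < cdf M t"
    using cdf_lim_at_top_prob \<open>u < 1\<close> by (rule order_tendstoD)
  then obtain t where "u < cdf M t"
    by (auto simp: eventually_at_top_linorder)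
  then show "{t. u \<le> cdf M t} \<noteq> {}"
    by (auto intro: less_imp_le)
  have "\<forall>\<^sub>F t in at_bot. cdf M t < u"
    using cdf_lim_at_bot \<open>0 < u\<close> by (rule order_tendstoD)
  then obtain s where "\<And>t. t \<le> s \<Longrightarrow> cdf M t < u"
    by (auto simp: eventually_at_bot_linorder)
  then show "bdd_below {t. u \<le> cdf M t}"
    by (intro bdd_belowI [of _ s]) (force simp: not_less [symmetric])
qed

text \<open>Raising the level shrinks the set over which the infimum is taken. Monotonicity serves
  to obtain measurability.\<close>

lemma quantile_mono_on:
  assumes "real_distribution M"
  shows "mono_on {0<..<1} (quantile M)"
  unfolding quantile_def
  using quantile_set_bounds [OF assms] by (intro mono_onI cInf_superset_mono) auto

lemma borel_measurable_quantile:
  assumes "real_distribution M"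
  shows "quantile M \<in> borel_measurable (lebesgue_on {0<..<1})"
proof -
  have "quantile M \<in> borel_measurable (restrict_space borel {0<..<1})"
    by (intro borel_measurable_mono_on_fnc quantile_mono_on assms)
  \<comment> \<open>Extension by zero gives a function on the whole line, where Borel measurability
    passes to the completion \<open>lebesgue\<close>.\<close>
  then have "(\<lambda>u. indicator {0<..<1} u *\<^sub>R quantile M u) \<in> borel_measurable lborel"
    by (subst (asm) borel_measurable_restrict_space_iff) auto
  then have "(\<lambda>u. indicator {0<..<1} u *\<^sub>R quantile M u) \<in> borel_measurable lebesgue"
    by (rule measurable_completion)
  then show ?thesis
    by (subst borel_measurable_restrict_space_iff) auto
qed

text \<open>Translation by \<open>h\<close> maps the set defining \<open>quantile M u\<close> into
  the one defining \<open>quantile N u\<close>, so the infima differ by at most \<open>h\<close> in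
  this direction.\<close>

lemma quantile_le_shift:
  assumes "real_distribution M" and "real_distribution N"
    and le: "\<And>t. cdf M t \<le> cdf N (t + h)" and u: "0 < u" "u < 1"
  shows "quantile N u \<le> quantile M u + h"
proof -
  have "quantile N u - h \<le> quantile M u"
    unfolding quantile_def [of M]
  proof (rule cInf_greatest)
    fix t assume "t \<in> {t. u \<le> cdf M t}"
    then have "t + h \<in> {t. u \<le> cdf N t}"
      using le [of t] by auto
    then have "quantile N u \<le> t + h"
      unfolding quantile_def using quantile_set_bounds(2) assms(2) u by (intro cInf_lower)
    then show "quantile N u - h \<le> t"
      by simp
  qed (use quantile_set_bounds(1) assms(1) u in auto)
  then show ?thesis
    by simp
qed

text \<open>With total mass 1, a uniform bound is also a bound in every \<open>L^p\<close>.
  Boundedness gives integrability, which excludes the infinite branch of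
  \<open>Lp_norm\<close>.\<close>

lemma (in prob_space) Lp_norm_le_bound:
  assumes f: "f \<in> borel_measurable M" and bound: "\<And>\<omega>. \<omega> \<in> space M \<Longrightarrow> \<bar>f \<omega>\<bar> \<le> c"
    and "0 < p"
  shows "Lp_norm M p f \<le> ennreal c"
proof -
  \<comment> \<open>The space is nonempty, so \<open>c\<close> bounds some absolute value. The
    cancellation \<open>(c powr p) powr (1 / p) = c\<close> relies on this.\<close>
  have "0 \<le> c"
    using bound not_empty by force
  have le: "\<bar>f \<omega>\<bar> powr p \<le> c powr p" if "\<omega> \<in> space M" for \<omega>
    using bound [OF that] \<open>0 < p\<close> by (intro powr_mono2) auto
  have int: "integrable M (\<lambda>\<omega>. \<bar>f \<omega>\<bar> powr p)"
    using f le by (intro integrable_const_bound [of _ "c powr p"]) auto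
  have "(\<integral>\<omega>. \<bar>f \<omega>\<bar> powr p \<partial>M) \<le> c powr p"
    using int le by (intro integral_le_const) auto
  then have "(\<integral>\<omega>. \<bar>f \<omega>\<bar> powr p \<partial>M) powr (1 / p) \<le> (c powr p) powr (1 / p)"
    using \<open>0 < p\<close> by (intro powr_mono2) auto
  also have "\<dots> = c"
    using \<open>0 < p\<close> \<open>0 \<le> c\<close> by (simp add: powr_powr)
  finally show ?thesis
    using f int by (simp add: Lp_norm_def ennreal_leI)
qed

text \<open>A set that catches exactly the mesh points up to index \<open>j\<close> collects the
  weights up to \<open>j\<close>, and these telescope. Keeping \<open>A\<close> general covers both
  \<open>UNIV\<close>, for the total mass, and \<open>{..t}\<close>, for the c.d.f.\<close>

lemma emeasure_mesh_measure_cutoff: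
  assumes "real_distribution \<mu>" and "mono_on {..n} x" and "A \<in> sets borel"
    and "j \<le> n" and A: "\<And>k. k \<le> n \<Longrightarrow> x k \<in> A \<longleftrightarrow> k \<le> j"
  shows "emeasure (mesh_measure \<mu> n x) A = ennreal (cdf \<mu> (x j))"
proof -
  interpret real_distribution \<mu> by fact
  \<comment> \<open>\<open>ennreal\<close> truncates negative reals to 0, so it commutes with the
    sum only for nonnegative weights.\<close>
  have nonneg: "0 \<le> cdf \<mu> (x k) - cdf \<mu> (x (k - 1))" if "k \<in> {1..n}" for k
    using that mono_onD [OF assms(2), of "k - 1" k] by (auto intro!: cdf_nondecreasing)
  have "(\<Sum>k=1..n. ennreal (cdf \<mu> (x k) - cdf \<mu> (x (k - 1))) * emeasure (return borel (x k)) A)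
      = (\<Sum>k=1..j. ennreal (cdf \<mu> (x k) - cdf \<mu> (x (k - 1))))"
    using A \<open>A \<in> sets borel\<close> \<open>j \<le> n\<close>
    by (intro sum.mono_neutral_cong_right) auto
  also have "\<dots> = ennreal (\<Sum>k=1..j. cdf \<mu> (x k) - cdf \<mu> (x (k - 1)))"
    using nonneg \<open>j \<le> n\<close> by (intro sum_ennreal) auto
  also have "(\<Sum>k=1..j. cdf \<mu> (x k) - cdf \<mu> (x (k - 1))) = cdf \<mu> (x j) - cdf \<mu> (x 0)"
    using sum_telescope'' [of 0 j "\<lambda>k. cdf \<mu> (x k)"] by (simp add: atLeastSucAtMost_greaterThanAtMost)
  finally show ?thesis
    using A [of 0] \<open>A \<in> sets borel\<close> mono_onD [OF assms(2), of 0 j] \<open>j \<le> n\<close>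
    by (simp add: emeasure_mesh_measure cdf_nonneg cdf_nondecreasing flip: ennreal_plus)
qed

lemma real_distribution_mesh_measure:
  assumes "real_distribution \<mu>" and "mono_on {..n} x" and "cdf \<mu> (x n) = 1"
  shows "real_distribution (mesh_measure \<mu> n x)"
proof -
  have "space (mesh_measure \<mu> n x) = UNIV"
    using sets_eq_imp_space_eq [OF sets_mesh_measure] by simp
  then have "prob_space (mesh_measure \<mu> n x)"
    using emeasure_mesh_measure_cutoff [OF assms(1,2), of UNIV n] assms(3)
    by (intro prob_spaceI) simp
  then show ?thesis
    by (simp add: real_distribution_def real_distribution_axioms_def)
qed

lemma cdf_mesh_measure:
  assumes "real_distribution \<mu>" and "mono_on {..n} x"
    and "j \<le> n" and "x j \<le> t" and "\<And>k. j < k \<Longrightarrow> k \<le> n \<Longrightarrow> t < x k"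
  shows "cdf (mesh_measure \<mu> n x) t = cdf \<mu> (x j)"
proof -
  interpret real_distribution \<mu> by fact
  have "x k \<in> {..t} \<longleftrightarrow> k \<le> j" if "k \<le> n" for k
    using that assms(3-5) mono_onD [OF assms(2), of k j] by (force simp: not_le [symmetric])
  then show ?thesis
    unfolding cdf_def [of "mesh_measure _ _ _"] measure_def
    using emeasure_mesh_measure_cutoff [OF assms(1,2), of "{..t}" j] \<open>j \<le> n\<close>
    by (simp add: cdf_nonneg)
qed

text \<open>This is the case without a cutoff index: the half-line misses every atom.\<close>

lemma cdf_mesh_measure_below:
  assumes "mono_on {..n} x" and "t < x 0"
  shows "cdf (mesh_measure \<mu> n x) t = 0"
proof -
  have "x k \<notin> {..t}" if "k \<le> n" for k
    using that mono_onD [OF assms(1), of 0 k] assms(2) by auto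
  then have "emeasure (mesh_measure \<mu> n x) {..t} = 0"
    by (simp add: emeasure_mesh_measure del: atMost_iff)
  then show ?thesis
    by (simp add: cdf_def measure_def)
qed

lemma mesh_cutoff_exists:
  fixes x :: "nat \<Rightarrow> real"
  assumes "x 0 \<le> t"
  obtains j where "j \<le> n" and "x j \<le> t" and "\<And>k. j < k \<Longrightarrow> k \<le> n \<Longrightarrow> t < x k"
proof -
  define J where "J = {k. k \<le> n \<and> x k \<le> t}"
  have "finite J" "J \<noteq> {}"
    using assms by (auto simp: J_def)
  then have "Max J \<in> J" "\<And>k. k \<in> J \<Longrightarrow> k \<le> Max J"
    by auto
  then show thesis
    by (intro that [of "Max J"]) (force simp: J_def not_le [symmetric])+
qed

lemma cdf_mesh_measure_le:
  assumes "real_distribution \<mu>" and "mono_on {..n} x"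
  shows "cdf (mesh_measure \<mu> n x) t \<le> cdf \<mu> t"
proof -
  interpret real_distribution \<mu> by fact
  show ?thesis
  proof (cases "t < x 0")
    case True
    then show ?thesis
      by (simp add: cdf_mesh_measure_below [OF assms(2)] cdf_nonneg)
  next
    case False
    then obtain j where "j \<le> n" "x j \<le> t" "\<And>k. j < k \<Longrightarrow> k \<le> n \<Longrightarrow> t < x k"
      using mesh_cutoff_exists [of x t n] by auto
    then show ?thesis
      using cdf_mesh_measure [OF assms, of j t] by (simp add: cdf_nondecreasing)
  qed
qed

text \<open>The mesh point following \<open>t\<close> is at most \<open>t + h\<close>, and there
  both c.d.f.s agree with a value at least \<open>cdf \<mu> t\<close>. Outside the mesh the support
  decides: the c.d.f. of \<open>\<mu>\<close> is 0 on the left and 1 on the right.\<close>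

lemma cdf_le_cdf_mesh_measure_shift:
  assumes "real_distribution \<mu>" and x: "strict_mono_on {..n} x"
    and supp: "measure_support \<mu> \<subseteq> {x 0..x n}"
    and h: "\<And>k. k \<in> {1..n} \<Longrightarrow> x k - x (k - 1) \<le> h" and "0 \<le> h"
  shows "cdf \<mu> t \<le> cdf (mesh_measure \<mu> n x) (t + h)"
proof -
  note mono = strict_mono_on_imp_mono_on [OF x]
  have F1: "cdf \<mu> (x n) = 1"
    using cdf_eq_1_if_support [OF assms(1) supp] by simp
  interpret real_distribution \<mu> by fact
  interpret mesh: real_distribution "mesh_measure \<mu> n x"
    by (rule real_distribution_mesh_measure [OF assms(1) mono F1])
  show ?thesis
  proof (cases "t < x 0")
    case True
    then show ?thesis
      using cdf_eq_0_if_support [OF assms(1) supp] by (simp add: mesh.cdf_nonneg)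
  next
    case False
    then obtain j where j: "j \<le> n" "x j \<le> t" "\<And>k. j < k \<Longrightarrow> k \<le> n \<Longrightarrow> t < x k"
      using mesh_cutoff_exists [of x t n] by auto
    \<comment> \<open>The index of the next mesh point, capped at \<open>n\<close>: for
      \<open>j = n\<close> there is none, but \<open>cdf \<mu> (x n) = 1\<close> already
      dominates.\<close>
    define i where "i = min (Suc j) n"
    have "x i \<le> t + h"
      using j h [of "Suc j"] \<open>0 \<le> h\<close> by (cases "j = n") (auto simp: i_def min_def)
    moreover have "cdf \<mu> t \<le> cdf \<mu> (x i)"
      using j(1) j(3) [of "Suc j"] F1 cdf_bounded_prob [of t]
      by (cases "j = n") (auto simp: i_def min_def intro: cdf_nondecreasing)
    \<comment> \<open>Strictness of the mesh makes \<open>i\<close> its own cutoff index.\<close>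
    moreover have "cdf (mesh_measure \<mu> n x) (x i) = cdf \<mu> (x i)"
      using strict_mono_onD [OF x, of i] by (intro cdf_mesh_measure [OF assms(1) mono]) (auto simp: i_def)
    ultimately show ?thesis
      using mesh.cdf_nondecreasing [of "x i" "t + h"] by simp
  qed
qed

theorem proposition14:
  fixes \<mu> :: "real measure" and a b p :: real and n :: nat and x :: "nat \<Rightarrow> real"
  assumes "real_distribution \<mu>"
    and "a < b" and "measure_support \<mu> = {a..b}"
    and "finite {t. measure \<mu> {t} > 0}"
    and "n \<ge> 1"
    and "x 0 = a" and "x n = b" and "strict_mono_on {..n} x"
    and "p \<ge> 1"
  shows "Lp_norm (lebesgue_on {0<..<1}) p (\<lambda>u. quantile \<mu> u - quantile (mesh_measure \<mu> n x) u)
           \<le> ennreal (MAX k\<in>{1..n}. x k - x (k - 1))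
       \<and> ((\<forall>k\<le>n. x k = a + (b - a) / real n * real k) \<longrightarrow>
          Lp_norm (lebesgue_on {0<..<1}) p (\<lambda>u. quantile \<mu> u - quantile (mesh_measure \<mu> n x) u)
            \<le> ennreal ((b - a) / real n))"
proof -
  define h where "h = (MAX k\<in>{1..n}. x k - x (k - 1))"
  define \<nu> where "\<nu> = mesh_measure \<mu> n x"
  note mono = strict_mono_on_imp_mono_on [OF assms(8)]
  have h: "x k - x (k - 1) \<le> h" if "k \<in> {1..n}" for k
    unfolding h_def using that by (intro Max_ge) auto
  have "0 \<le> h"
    using h [of 1] mono_onD [OF mono, of 0 1] \<open>n \<ge> 1\<close> by auto
  have supp: "measure_support \<mu> \<subseteq> {x 0..x n}"
    using assms by simp
  have \<nu>: "real_distribution \<nu>"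
    unfolding \<nu>_def using cdf_eq_1_if_support [OF assms(1) supp]
    by (intro real_distribution_mesh_measure assms(1) mono) simp
  interpret prob_space "lebesgue_on {0<..<1::real}"
    by (rule prob_spaceI) (simp add: emeasure_restrict_space)
  have "\<bar>quantile \<mu> u - quantile \<nu> u\<bar> \<le> h" if "0 < u" "u < 1" for u
  proof -
    \<comment> \<open>The summand 0 matches the shift lemma with zero shift; the roles of the two
      measures are swapped in the second inequality.\<close>
    have "quantile \<mu> u \<le> quantile \<nu> u + 0"
      using cdf_mesh_measure_le [OF assms(1) mono]
      by (intro quantile_le_shift assms(1) \<nu> that) (simp add: \<nu>_def)
    moreover have "quantile \<nu> u \<le> quantile \<mu> u + h"
      using cdf_le_cdf_mesh_measure_shift [OF assms(1,8) supp h \<open>0 \<le> h\<close>]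
      by (intro quantile_le_shift assms(1) \<nu> that) (simp add: \<nu>_def)
    ultimately show ?thesis
      using \<open>0 \<le> h\<close> by simp
  qed
  then have main: "Lp_norm (lebesgue_on {0<..<1}) p (\<lambda>u. quantile \<mu> u - quantile \<nu> u) \<le> ennreal h"
    using assms(1) \<nu> \<open>p \<ge> 1\<close>
    by (intro Lp_norm_le_bound borel_measurable_diff borel_measurable_quantile) auto
  moreover have "h = (b - a) / real n" if unif: "\<forall>k\<le>n. x k = a + (b - a) / real n * real k"
  proof -
    have "x k - x (k - 1) = (b - a) / real n" if "k \<in> {1..n}" for k
    proof -
      have "x k - x (k - 1) = (b - a) / real n * (real k - real (k - 1))"
        using that unif by (subst (1 2) unif [rule_format]) (auto simp: right_diff_distrib)
      also have "real k - real (k - 1) = 1"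
        using that by (simp add: of_nat_diff)
      finally show ?thesis by simp
    qed
    \<comment> \<open>All gaps coincide, and \<open>n \<ge> 1\<close> makes the index set nonempty,
      so the maximum runs over a singleton.\<close>
    then have "(\<lambda>k. x k - x (k - 1)) ` {1..n} = {(b - a) / real n}"
      using \<open>n \<ge> 1\<close> by force
    then show ?thesis
      by (simp add: h_def)
  qed
  ultimately show ?thesis
    unfolding h_def [symmetric] \<nu>_def [symmetric] by metis
qed

end
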